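(* Let $\pi,\tau\in\mathfrak{S}_m$ be in standard form. If $\pi$ and $\tau$ are strongly c-Wilf equivalent, then $\pi_m-\pi_1=\tau_m-\tau_1$.
   Context: $\mathfrak{S}_n$ is the symmetric group on $[n]$, permutations written $\sigma=\sigma_1\cdots\sigma_n$. The standardization $\operatorname{st}(w)$ of a word of distinct integers replaces its smallest entry by 1, the next smallest by 2, etc. For $\pi\in\mathfrak{S}_m$ and $\sigma\in\mathfrak{S}_n$, $\operatorname{Em}(\pi,\sigma)=\{i\in[n-m+1]:\operatorname{st}(\sigma_i\cdots\sigma_{i+m-1})=\pi\}$. Let $a^\pi_{n,k}$ be the number of $\sigma\in\mathfrak{S}_n$ with $|\operatorname{Em}(\pi,\sigma)|=k$. $\pi$ and $\tau$ are strongly c-Wilf equivalent if $a^\pi_{n,k}=a^\tau_{n,k}$ for all $n,k$. A permutation $\pi\in\mathfrak{S}_m$ is in standard form if $\pi_1<\pi_m$ and $\pi_1+\pi_m\le m+1$. *)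

theory Defs
  imports Main
begin

definition is_perm :: "nat \<Rightarrow> nat list \<Rightarrow> bool" where
  "is_perm n p \<longleftrightarrow> length p = n \<and> distinct p \<and> set p = {1..n}"

definition perms :: "nat \<Rightarrow> nat list set" where
  "perms n = {p. is_perm n p}"

definition st :: "nat list \<Rightarrow> nat list" where
  "st w = map (\<lambda>x. card {y \<in> set w. y \<le> x}) w"

definition Em :: "nat list \<Rightarrow> nat list \<Rightarrow> nat set" where
  "Em pi sigma = {i. 1 \<le> i \<and> i + length pi \<le> length sigma + 1 \<and>
      st (take (length pi) (drop (i - 1) sigma)) = pi}"

definition a_count :: "nat list \<Rightarrow> nat \<Rightarrow> nat \<Rightarrow> nat" where
  "a_count pi n k = card {sigma \<in> perms n. card (Em pi sigma) = k}"

definition strongly_cWilf_equiv :: "nat list \<Rightarrow> nat list \<Rightarrow> bool" where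
  "strongly_cWilf_equiv pi tau \<longleftrightarrow> (\<forall>n k. a_count pi n k = a_count tau n k)"

definition standard_form :: "nat list \<Rightarrow> bool" where
  "standard_form p \<longleftrightarrow> hd p < last p \<and> hd p + last p \<le> length p + 1"

end

theory Submission
  imports Defs "HOL-Combinatorics.Multiset_Permutations" "HOL-Computational_Algebra.Polynomial"
begin

text \<open>For a word with \<open>j\<close> occurrences, the sum of \<open>x ^ card S\<close> over the sets \<open>S\<close> of marked occurrences
  is \<open>(1 + x) ^ j\<close>, so \<open>a_count\<close> determines the numbers of words with marked occurrences. Cutting off
  the first cluster (the cluster method) shows that it also determines the number of clusters with given
  length and given number of marked occurrences. Let \<open>m = e + 1\<close>. The only way to cover \<open>k * e + 1\<close>
  positions with \<open>k\<close> marked occurrences in one cluster is to let consecutive ones share exactly one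
  position. Put \<open>d = pi ! e - pi ! 0 > 0\<close>. In such a cluster \<open>k * d + 1\<close> entries form an increasing
  chain, so there are at most \<open>fact (k * e + 1) / fact (k * d + 1)\<close> of them; an explicit construction
  yields at least \<open>fact k ^ (e - d)\<close>. Up to factors exponential in \<open>k\<close> both bounds are
  \<open>k ^ (k * (e - d))\<close>, so the growth rate in \<open>k\<close> determines \<open>d\<close>.\<close>

section \<open>Marked occurrences\<close>

definition starts :: "nat \<Rightarrow> nat \<Rightarrow> nat set" where
  "starts m n = {s. s + m \<le> n}"

text \<open>Positions start at 0 here, but at 1 in \<^const>\<open>Em\<close>.\<close>

definition occurrences :: "nat list \<Rightarrow> nat list \<Rightarrow> nat set" where
  "occurrences p w = {s \<in> starts (length p) (length w). st (take (length p) (drop s w)) = p}"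

definition marked_words :: "nat list \<Rightarrow> nat set \<Rightarrow> nat set \<Rightarrow> nat list set" where
  "marked_words p A S = {w \<in> permutations_of_set A. S \<subseteq> occurrences p w}"

definition marked_count :: "nat list \<Rightarrow> nat \<Rightarrow> nat set \<Rightarrow> nat" where
  "marked_count p n S = card (marked_words p {1..n} S)"

definition marked_sum :: "nat list \<Rightarrow> 'a::comm_semiring_1 \<Rightarrow> nat \<Rightarrow> 'a" where
  "marked_sum p x n = (\<Sum>S\<in>Pow (starts (length p) n). of_nat (marked_count p n S) * x ^ card S)"

lemma perms_eq_permutations_of_set: "perms n = permutations_of_set {1..n}"
  by (auto simp: perms_def is_perm_def permutations_of_set_def dest: distinct_card)

lemma permsD:
  assumes "p \<in> perms m"
  shows "length p = m" "distinct p" "set p = {1..m}"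
  using assms by (auto simp: perms_def is_perm_def)

lemma perms_ends:
  assumes "p \<in> perms (Suc e)"
  shows "p \<noteq> []" "hd p = p ! 0" "last p = p ! e"
proof -
  show "p \<noteq> []" using permsD(1)[OF assms] by auto
  then show "hd p = p ! 0" "last p = p ! e"
    using permsD(1)[OF assms] by (simp_all add: hd_conv_nth last_conv_nth)
qed

lemma finite_starts [simp]: "finite (starts m n)"
  by (rule finite_subset[of _ "{..n}"]) (auto simp: starts_def)

lemma st_less_iff:
  assumes "x < length w" "y < length w"
  shows "st w ! x < st w ! y \<longleftrightarrow> w ! x < w ! y"
proof -
  have mono: "card {z \<in> set w. z \<le> u} < card {z \<in> set w. z \<le> v}" if "v \<in> set w" "u < v" for u v
  proof (rule psubset_card_mono)
    have "v \<in> {z \<in> set w. z \<le> v} - {z \<in> set w. z \<le> u}" using that by simp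
    moreover have "{z \<in> set w. z \<le> u} \<subseteq> {z \<in> set w. z \<le> v}" using that by auto
    ultimately show "{z \<in> set w. z \<le> u} \<subset> {z \<in> set w. z \<le> v}" by blast
  qed simp
  show ?thesis
    using mono[of "w ! y" "w ! x"] mono[of "w ! x" "w ! y"] assms
    by (cases "w ! x" "w ! y" rule: linorder_cases) (auto simp: st_def)
qed

lemma st_map:
  assumes "strict_mono_on (set w) f"
  shows "st (map f w) = st w"
proof -
  have "card {y \<in> f ` set w. y \<le> f x} = card {y \<in> set w. y \<le> x}" if "x \<in> set w" for x
  proof -
    have "{y \<in> f ` set w. y \<le> f x} = f ` {y \<in> set w. y \<le> x}"
      using strict_mono_on_less_eq[OF assms _ that] by auto
    moreover have "inj_on f {y \<in> set w. y \<le> x}"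
      using strict_mono_on_imp_inj_on[OF assms] by (rule inj_on_subset) auto
    ultimately show ?thesis by (simp add: card_image)
  qed
  then show ?thesis by (simp add: st_def)
qed

lemma st_perms:
  assumes "p \<in> perms m"
  shows "st p = p"
  unfolding st_def
proof (rule map_idI)
  fix x assume "x \<in> set p"
  then have "{y \<in> set p. y \<le> x} = {1..x}" using permsD(3)[OF assms] by auto
  then show "card {y \<in> set p. y \<le> x} = x" by simp
qed

lemma occurrence_less_iff:
  assumes "s \<in> occurrences p w" "x < length p" "y < length p"
  shows "w ! (s + x) < w ! (s + y) \<longleftrightarrow> p ! x < p ! y"
proof -
  let ?u = "take (length p) (drop s w)"
  have "st ?u = p" "s + length p \<le> length w"
    using assms(1) by (auto simp: occurrences_def starts_def)
  then show ?thesis using st_less_iff[of x ?u y] assms(2,3) by simp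
qed

lemma Em_eq_Suc_occurrences: "Em p w = Suc ` occurrences p w"
proof -
  have "i \<in> Em p w \<longleftrightarrow> i \<in> Suc ` occurrences p w" for i
    by (cases i) (auto simp: Em_def occurrences_def starts_def)
  then show ?thesis by blast
qed

lemma occurrences_map:
  assumes "strict_mono_on (set w) f"
  shows "occurrences p (map f w) = occurrences p w"
proof -
  have "st (take (length p) (drop s (map f w))) = st (take (length p) (drop s w))" for s
  proof -
    have "set (take (length p) (drop s w)) \<subseteq> set w"
      by (meson in_set_dropD in_set_takeD subsetI)
    then show ?thesis
      using st_map[of "take (length p) (drop s w)" f] monotone_on_subset[OF assms]
      by (simp add: take_map drop_map)
  qed
  then show ?thesis by (simp add: occurrences_def)
qed

lemma occurrences_subset_starts: "occurrences p w \<subseteq> starts (length p) (length w)"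
  by (auto simp: occurrences_def)

lemma sum_Pow_power_card:
  fixes x :: "'a::comm_semiring_1"
  assumes "finite A"
  shows "(\<Sum>S\<in>Pow A. x ^ card S) = (1 + x) ^ card A"
  using prod_add[OF assms, of "\<lambda>_. x" "\<lambda>_. 1"] by (simp add: add.commute)

lemma marked_sum_eq_sum_a_count:
  "marked_sum p x n = (\<Sum>k\<le>Suc n. of_nat (a_count p n k) * (1 + x) ^ k)"
proof -
  let ?W = "permutations_of_set {1..n}" and ?P = "Pow (starts (length p) n)"
  have length_eq: "length w = n" if "w \<in> ?W" for w
    using length_finite_permutations_of_set[OF that] by simp
  have Em_bound: "card (Em p w) \<le> Suc n" if "w \<in> ?W" for w
    using card_mono[of "{1..Suc n}" "Em p w"] length_eq[OF that] by (fastforce simp: Em_def)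
  have "marked_sum p x n = (\<Sum>S\<in>?P. \<Sum>w\<in>?W. if S \<subseteq> occurrences p w then x ^ card S else 0)"
    by (simp add: marked_sum_def marked_count_def marked_words_def sum.If_cases Int_def)
  also have "\<dots> = (\<Sum>w\<in>?W. \<Sum>S\<in>?P. if S \<subseteq> occurrences p w then x ^ card S else 0)"
    by (rule sum.swap)
  also have "\<dots> = (\<Sum>w\<in>?W. (1 + x) ^ card (Em p w))"
  proof (rule sum.cong[OF refl])
    fix w assume "w \<in> ?W"
    then have occ: "occurrences p w \<subseteq> starts (length p) n"
      using occurrences_subset_starts[of p w] by (simp add: length_eq)
    have "(\<Sum>S\<in>?P. if S \<subseteq> occurrences p w then x ^ card S else 0)
        = (\<Sum>S\<in>Pow (occurrences p w). x ^ card S)"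
      using occ by (intro sum.mono_neutral_cong_right) auto
    also have "\<dots> = (1 + x) ^ card (occurrences p w)"
      using finite_subset[OF occ] by (intro sum_Pow_power_card) simp
    finally show "(\<Sum>S\<in>?P. if S \<subseteq> occurrences p w then x ^ card S else 0) = (1 + x) ^ card (Em p w)"
      by (simp add: Em_eq_Suc_occurrences card_image)
  qed
  also have "\<dots> = (\<Sum>k\<le>Suc n. \<Sum>w | w \<in> ?W \<and> card (Em p w) = k. (1 + x) ^ card (Em p w))"
    using Em_bound by (intro sum.group[symmetric]) auto
  also have "\<dots> = (\<Sum>k\<le>Suc n. of_nat (a_count p n k) * (1 + x) ^ k)"
    by (intro sum.cong) (auto simp: a_count_def perms_eq_permutations_of_set)
  finally show ?thesis .
qed

section \<open>The cluster recursion\<close>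

lemma card_marked_words_image:
  assumes "strict_mono_on A f"
  shows "card (marked_words p (f ` A) S) = card (marked_words p A S)"
proof -
  have inj: "inj_on f A" using assms by (rule strict_mono_on_imp_inj_on)
  have "occurrences p (map f w) = occurrences p w" if "w \<in> permutations_of_set A" for w
    using assms permutations_of_setD(1)[OF that] by (simp add: occurrences_map)
  then have "marked_words p (f ` A) S = map f ` marked_words p A S"
    by (auto simp: marked_words_def permutations_of_set_image_inj[OF inj])
  moreover have "inj_on (map f) (marked_words p A S)"
    by (rule inj_onI, rule map_inj_on)
      (use inj in \<open>auto simp: marked_words_def permutations_of_set_def\<close>)
  ultimately show ?thesis by (simp add: card_image)
qed

lemma card_marked_words:
  assumes "finite A"
  shows "card (marked_words p A S) = marked_count p (card A) S"
proof -
  have "card (marked_words p B S) = card (marked_words p {..<card B} S)" if "finite B" for B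
  proof -
    obtain h where "bij_betw h {..<card B} B" "strict_mono_on {..<card B} h"
      using ex_bij_betw_strict_mono_card[OF \<open>finite B\<close>] .
    then show ?thesis using card_marked_words_image[of "{..<card B}" h p S] by (simp add: bij_betw_def)
  qed
  from this[OF assms] this[of "{1..card A}"] show ?thesis by (simp add: marked_count_def)
qed

lemma marked_words_append_iff:
  assumes "p \<noteq> []" and S: "S \<subseteq> starts (length p) (length u)"
  shows "u @ v \<in> marked_words p A (S \<union> (+) (length u) ` T) \<longleftrightarrow>
    set u \<subseteq> A \<and> u \<in> marked_words p (set u) S \<and> v \<in> marked_words p (A - set u) T"
proof -
  have "s \<in> occurrences p (u @ v) \<longleftrightarrow> s \<in> occurrences p u" if "s \<in> S" for s
    using that S by (auto simp: occurrences_def starts_def)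
  moreover have "length u + t \<in> occurrences p (u @ v) \<longleftrightarrow> t \<in> occurrences p v" for t
    by (auto simp: occurrences_def starts_def)
  ultimately have "S \<union> (+) (length u) ` T \<subseteq> occurrences p (u @ v)
      \<longleftrightarrow> S \<subseteq> occurrences p u \<and> T \<subseteq> occurrences p v" by blast
  then show ?thesis by (auto simp: marked_words_def permutations_of_set_def)
qed

lemma bij_betw_append_marked_words:
  assumes "p \<noteq> []" "l \<le> n" and S: "S \<subseteq> starts (length p) l"
  shows "bij_betw (\<lambda>(B, u, v). u @ v)
    (SIGMA B:{B. B \<subseteq> {1..n} \<and> card B = l}. marked_words p B S \<times> marked_words p ({1..n} - B) T)
    (marked_words p {1..n} (S \<union> (+) l ` T))" (is "bij_betw ?append ?D ?M")
proof -
  let ?split = "\<lambda>w. (set (take l w), take l w, drop l w)"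
  have append_iff: "u @ v \<in> ?M \<longleftrightarrow> (set u, u, v) \<in> ?D" if "length u = l" for u v
    using marked_words_append_iff[OF assms(1), of S u v "{1..n}" T] S that
    by (auto simp: marked_words_def permutations_of_set_def distinct_card)
  have fiber: "set u = B \<and> length u = l" if "(B, u, v) \<in> ?D" for B u v
    using that by (auto simp: marked_words_def permutations_of_set_def distinct_card)
  show ?thesis
  proof (rule bij_betw_byWitness[where f' = ?split])
    show "\<forall>x\<in>?D. ?split (?append x) = x"
      using fiber by auto
    show "?append ` ?D \<subseteq> ?M"
    proof (intro image_subsetI)
      fix x assume "x \<in> ?D"
      then obtain B u v where x: "x = (B, u, v)" "(B, u, v) \<in> ?D" by (cases x) simp
      then have "(set u, u, v) \<in> ?D" "length u = l" using fiber[OF x(2)] by auto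
      then show "?append x \<in> ?M" using append_iff by (simp add: x(1))
    qed
    show "?split ` ?M \<subseteq> ?D"
    proof (intro image_subsetI)
      fix w assume w: "w \<in> ?M"
      then have "w \<in> permutations_of_set {1..n}" by (simp add: marked_words_def)
      then have "length w = n" using length_finite_permutations_of_set by fastforce
      then show "?split w \<in> ?D"
        using append_iff[of "take l w" "drop l w"] w \<open>l \<le> n\<close> by simp
    qed
  qed simp
qed

lemma marked_count_Un_shift:
  assumes "p \<noteq> []" "l \<le> n" "S \<subseteq> starts (length p) l"
  shows "marked_count p n (S \<union> (+) l ` T)
    = (n choose l) * marked_count p l S * marked_count p (n - l) T"
proof -
  let ?B = "{B. B \<subseteq> {1..n} \<and> card B = l}"
  let ?X = "\<lambda>B. marked_words p B S \<times> marked_words p ({1..n} - B) T"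
  have "marked_count p n (S \<union> (+) l ` T) = card (Sigma ?B ?X)"
    using bij_betw_same_card[OF bij_betw_append_marked_words[OF assms]] by (simp add: marked_count_def)
  also have "\<dots> = (\<Sum>B\<in>?B. card (?X B))"
    by (rule card_SigmaI) (simp_all add: marked_words_def)
  also have "\<dots> = (\<Sum>B\<in>?B. marked_count p l S * marked_count p (n - l) T)"
  proof (rule sum.cong[OF refl])
    fix B assume "B \<in> ?B"
    then have "card B = l" "card ({1..n} - B) = n - l" "finite B"
      using finite_subset[of B "{1..n}"] by (auto simp: card_Diff_subset)
    then show "card (?X B) = marked_count p l S * marked_count p (n - l) T"
      by (simp add: card_cartesian_product card_marked_words)
  qed
  also have "\<dots> = (n choose l) * marked_count p l S * marked_count p (n - l) T"
    by (simp add: n_subsets)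
  finally show ?thesis .
qed

definition bridged :: "nat \<Rightarrow> nat set \<Rightarrow> nat set" where
  "bridged m S = (\<Union>s\<in>S. {s<..<s + m})"

text \<open>With this definition the empty set is a cluster of length 1, so every set of starts is uniquely
  a concatenation of clusters.\<close>

definition clusters :: "nat \<Rightarrow> nat \<Rightarrow> nat set set" where
  "clusters m n = {S. S \<subseteq> starts m n \<and> {0<..<n} \<subseteq> bridged m S}"

definition cluster_sum :: "nat list \<Rightarrow> 'a::comm_semiring_1 \<Rightarrow> nat \<Rightarrow> 'a" where
  "cluster_sum p x n = (\<Sum>S\<in>clusters (length p) n. of_nat (marked_count p n S) * x ^ card S)"

definition first_cut :: "nat \<Rightarrow> nat set \<Rightarrow> nat" where
  "first_cut m S = (LEAST l. 0 < l \<and> l \<notin> bridged m S)"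

lemma finite_clusters [simp]: "finite (clusters m n)"
  by (rule finite_subset[of _ "Pow (starts m n)"]) (auto simp: clusters_def)

lemma
  assumes "S \<subseteq> starts m n" "n > 0"
  shows first_cut_pos: "0 < first_cut m S"
    and first_cut_not_bridged: "first_cut m S \<notin> bridged m S"
    and first_cut_le: "first_cut m S \<le> n"
proof -
  have end_cut: "0 < n \<and> n \<notin> bridged m S" using assms by (auto simp: bridged_def starts_def)
  show "0 < first_cut m S" "first_cut m S \<notin> bridged m S" "first_cut m S \<le> n"
    using LeastI[of "\<lambda>l. 0 < l \<and> l \<notin> bridged m S", OF end_cut]
      Least_le[of "\<lambda>l. 0 < l \<and> l \<notin> bridged m S", OF end_cut] by (auto simp: first_cut_def)
qed

lemma first_cut_cluster_Un:
  assumes "l > 0" and S: "S \<in> clusters m l"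
  shows "first_cut m (S \<union> (+) l ` T) = l"
  unfolding first_cut_def
proof (rule Least_equality)
  show "0 < l \<and> l \<notin> bridged m (S \<union> (+) l ` T)"
    using assms by (auto simp: bridged_def clusters_def starts_def)
next
  fix l' assume "0 < l' \<and> l' \<notin> bridged m (S \<union> (+) l ` T)"
  then have "0 < l'" "l' \<notin> bridged m S" by (auto simp: bridged_def)
  then have "l' \<notin> {0<..<l}" using S unfolding clusters_def by blast
  then show "l \<le> l'" using \<open>0 < l'\<close> by simp
qed

lemma cluster_below_first_cut:
  assumes "S \<subseteq> starts m n" "n > 0"
  shows "S \<inter> {..<first_cut m S} \<in> clusters m (first_cut m S)"
proof -
  have "S \<inter> {..<first_cut m S} \<subseteq> starts m (first_cut m S)"
    using first_cut_not_bridged[OF assms] by (auto simp: bridged_def starts_def)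
  moreover have "l \<in> bridged m (S \<inter> {..<first_cut m S})" if "0 < l" "l < first_cut m S" for l
  proof -
    have "l \<in> bridged m S" using not_less_Least[OF that(2)[unfolded first_cut_def]] that(1) by simp
    then show ?thesis using that(2) by (auto simp: bridged_def)
  qed
  ultimately show ?thesis by (auto simp: clusters_def)
qed

lemma bij_betw_first_cluster:
  assumes "m > 0" "n > 0"
  shows "bij_betw (\<lambda>(l, S, T). S \<union> (+) l ` T)
    (SIGMA l:{1..n}. clusters m l \<times> Pow (starts m (n - l))) (Pow (starts m n))"
    (is "bij_betw ?glue ?D ?U")
proof -
  let ?split = "\<lambda>U. (first_cut m U, U \<inter> {..<first_cut m U}, {t. first_cut m U + t \<in> U})"
  show ?thesis
  proof (rule bij_betw_byWitness[where f' = ?split])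
    show "\<forall>x\<in>?D. ?split (?glue x) = x"
    proof
      fix x assume "x \<in> ?D"
      then obtain l S T where x: "x = (l, S, T)" and "l > 0" and S: "S \<in> clusters m l"
        by (cases x) auto
      have below: "s < l" if "s \<in> S" for s
        using S that \<open>m > 0\<close> by (force simp: clusters_def starts_def)
      have "(S \<union> (+) l ` T) \<inter> {..<l} = S" "{t. l + t \<in> S \<union> (+) l ` T} = T"
        using below by force+
      then show "?split (?glue x) = x" by (simp add: x first_cut_cluster_Un[OF \<open>l > 0\<close> S])
    qed
    show "\<forall>U\<in>?U. ?glue (?split U) = U"
    proof
      fix U
      have "u \<in> (+) (first_cut m U) ` {t. first_cut m U + t \<in> U}" if "u \<in> U" "first_cut m U \<le> u" for u
        using that by (intro image_eqI[of _ _ "u - first_cut m U"]) auto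
      then show "?glue (?split U) = U" by (auto simp: not_less[symmetric])
    qed
    show "?glue ` ?D \<subseteq> ?U"
      by (fastforce simp: clusters_def starts_def)
    show "?split ` ?U \<subseteq> ?D"
      using first_cut_pos[OF _ \<open>n > 0\<close>] first_cut_le[OF _ \<open>n > 0\<close>]
        cluster_below_first_cut[OF _ \<open>n > 0\<close>]
      by (fastforce simp: starts_def Suc_le_eq)
  qed
qed

lemma card_Un_shift:
  assumes "m > 0" and S: "S \<subseteq> starts m l" and T: "finite T"
  shows "card (S \<union> (+) l ` T) = card S + card T"
proof -
  have "S \<inter> (+) l ` T = {}" using S \<open>m > 0\<close> by (fastforce simp: starts_def)
  then show ?thesis
    using finite_subset[OF S] T by (simp add: card_Un_disjoint card_image)
qed

lemma marked_sum_recursion: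
  fixes x :: "'a::comm_semiring_1"
  assumes "p \<noteq> []" "n > 0"
  shows "marked_sum p x n
    = (\<Sum>l=1..n. of_nat (n choose l) * cluster_sum p x l * marked_sum p x (n - l))"
proof -
  let ?m = "length p"
  let ?weight = "\<lambda>n S. of_nat (marked_count p n S) * x ^ card S"
  have weight_Un: "?weight n (S \<union> (+) l ` T)
      = of_nat (n choose l) * (?weight l S * ?weight (n - l) T)"
    if "l \<in> {1..n}" "S \<in> clusters ?m l" "T \<in> Pow (starts ?m (n - l))" for l S T
  proof -
    have "S \<subseteq> starts ?m l" "finite T"
      using that finite_subset[of T "starts ?m (n - l)"] by (auto simp: clusters_def)
    then show ?thesis
      using that(1) assms(1)
      by (simp add: marked_count_Un_shift card_Un_shift[of ?m] power_add mult_ac)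
  qed
  have "marked_sum p x n = (\<Sum>(l, S, T)\<in>(SIGMA l:{1..n}. clusters ?m l \<times> Pow (starts ?m (n - l))).
      ?weight n (S \<union> (+) l ` T))"
    unfolding marked_sum_def
    using sum.reindex_bij_betw[OF bij_betw_first_cluster[of ?m n], of "?weight n"] assms
    by (simp add: case_prod_unfold)
  also have "\<dots> = (\<Sum>l=1..n. \<Sum>S\<in>clusters ?m l. \<Sum>T\<in>Pow (starts ?m (n - l)).
      ?weight n (S \<union> (+) l ` T))"
    by (simp add: sum.Sigma)
  also have "\<dots> = (\<Sum>l=1..n. \<Sum>S\<in>clusters ?m l. \<Sum>T\<in>Pow (starts ?m (n - l)).
      of_nat (n choose l) * (?weight l S * ?weight (n - l) T))"
    by (intro sum.cong refl weight_Un)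
  also have "\<dots> = (\<Sum>l=1..n. of_nat (n choose l) * (cluster_sum p x l * marked_sum p x (n - l)))"
    unfolding cluster_sum_def marked_sum_def sum_product by (simp only: sum_distrib_left)
  finally show ?thesis by (simp only: mult.assoc)
qed

lemma marked_sum_0:
  assumes "p \<noteq> []"
  shows "marked_sum p x 0 = 1"
proof -
  have "starts (length p) 0 = {}" using assms by (simp add: starts_def)
  moreover have "marked_words p {1..0} {} = {[]}" by (auto simp: marked_words_def)
  ultimately show ?thesis by (simp add: marked_sum_def marked_count_def)
qed

lemma cluster_sum_cong:
  fixes x :: "'a::comm_semiring_1_cancel"
  assumes "p \<noteq> []" "q \<noteq> []"
    and marked_eq: "\<And>n. marked_sum p x n = marked_sum q x n"
    and "n > 0"
  shows "cluster_sum p x n = cluster_sum q x n"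
  using \<open>n > 0\<close>
proof (induction n rule: less_induct)
  case (less n)
  let ?rest = "\<lambda>r. \<Sum>l=1..<n. of_nat (n choose l) * cluster_sum r x l * marked_sum r x (n - l)"
  have last_cluster: "marked_sum r x n = cluster_sum r x n + ?rest r" if "r \<noteq> []" for r
  proof -
    have "{1..n} = insert n {1..<n}" using less.prems by auto
    then show ?thesis using less.prems by (simp add: marked_sum_recursion[OF that] marked_sum_0[OF that])
  qed
  have "?rest p = ?rest q"
    by (intro sum.cong refl) (simp add: marked_eq less.IH)
  then show ?case
    using last_cluster[OF assms(1)] last_cluster[OF assms(2)] marked_eq[of n] by simp
qed

lemma coeff_cluster_sum:
  "coeff (cluster_sum p (monom 1 1 :: 'a::comm_semiring_1 poly) n) k
    = of_nat (\<Sum>S | S \<in> clusters (length p) n \<and> card S = k. marked_count p n S)"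
proof -
  have "coeff (of_nat c * monom 1 1 ^ j) k = (if j = k then of_nat c else 0 :: 'a)" for c j :: nat
    by (simp add: monom_power of_nat_monom mult_monom)
  then have "coeff (cluster_sum p (monom 1 1 :: 'a poly) n) k
      = (\<Sum>S\<in>clusters (length p) n. if card S = k then of_nat (marked_count p n S) else 0)"
    by (simp add: cluster_sum_def coeff_sum)
  then show ?thesis by (simp add: sum.If_cases Int_def)
qed

section \<open>Linked clusters\<close>

definition linked_starts :: "nat \<Rightarrow> nat \<Rightarrow> nat set" where
  "linked_starts e k = (\<lambda>i. i * e) ` {..<k}"

lemma linked_starts_Suc: "linked_starts e (Suc k) = insert (k * e) (linked_starts e k)"
  by (simp add: linked_starts_def lessThan_Suc)

lemma linked_starts_add_le:
  assumes "s \<in> linked_starts e k"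
  shows "s + e \<le> k * e"
proof -
  obtain i where "i < k" "s = i * e" using assms by (auto simp: linked_starts_def)
  then show ?thesis using mult_le_mono1[of "Suc i" k e] by simp
qed

lemma eq_linked_starts_if_cover:
  assumes "e > 0" "finite S" "card S = k" "{0<..k * e} \<subseteq> (\<Union>s\<in>S. {s<..s + e})"
  shows "S = linked_starts e k"
  using assms(2-)
proof (induction k arbitrary: S)
  case 0
  then show ?case by (simp add: linked_starts_def)
next
  case (Suc k)
  have cover: "\<exists>s\<in>S. s < l \<and> l \<le> s + e" if "0 < l" "l \<le> Suc k * e" for l
    using subsetD[OF Suc.prems(3), of l] that by auto
  obtain s where s: "s \<in> S" "Suc k * e \<le> s + e" using cover[of "Suc k * e"] \<open>e > 0\<close> by auto
  obtain t where t: "t \<in> S" "t \<le> k * e" "k * e < t + e"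
    using cover[of "Suc (k * e)"] \<open>e > 0\<close> by (auto simp: less_Suc_eq_le Suc_le_eq)
  have "{0<..k * e} \<subseteq> (\<Union>s\<in>S - {s}. {s<..s + e})"
  proof
    fix l assume l: "l \<in> {0<..k * e}"
    then obtain u where "u \<in> S" "u < l" "l \<le> u + e" using cover[of l] by auto
    then show "l \<in> (\<Union>s\<in>S - {s}. {s<..s + e})" using l s(2) by (intro UN_I[of u]) auto
  qed
  then have rest: "S - {s} = linked_starts e k"
    using Suc.prems s(1) by (intro Suc.IH) auto
  have "t \<notin> S - {s}" using linked_starts_add_le[of t e k] t(3) unfolding rest by linarith
  then have "t = s" using t(1) by blast
  then have "s = k * e" using s(2) t(2) by simp
  then show ?case using rest s(1) by (auto simp: linked_starts_Suc)
qed

lemma card_linked_starts: "e > 0 \<Longrightarrow> card (linked_starts e k) = k"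
  by (simp add: linked_starts_def card_image inj_on_def)

lemma linked_starts_in_clusters:
  assumes "e > 0"
  shows "linked_starts e k \<in> clusters (Suc e) (Suc (k * e))"
proof -
  have "linked_starts e k \<subseteq> starts (Suc e) (Suc (k * e))"
    using linked_starts_add_le by (auto simp: starts_def)
  moreover have "l \<in> bridged (Suc e) (linked_starts e k)" if l: "0 < l" "l < Suc (k * e)" for l
  proof -
    define i where "i = (l - 1) div e"
    have "i < k" using l assms by (simp add: i_def less_mult_imp_div_less)
    moreover have "i * e \<le> l - 1" "l - 1 < i * e + e"
      using assms div_mult_mod_eq[of "l - 1" e] mod_less_divisor[of e "l - 1"]
      unfolding i_def by linarith+
    ultimately show ?thesis using l by (force simp: bridged_def linked_starts_def)
  qed
  ultimately show ?thesis by (auto simp: clusters_def)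
qed

lemma clusters_card_eq_linked_starts:
  assumes "e > 0"
  shows "{S \<in> clusters (Suc e) (Suc (k * e)). card S = k} = {linked_starts e k}"
proof (intro equalityI subsetI)
  fix S assume S: "S \<in> {S \<in> clusters (Suc e) (Suc (k * e)). card S = k}"
  then have "finite S" by (auto simp: clusters_def intro: finite_subset[OF _ finite_starts])
  moreover have "{0<..k * e} \<subseteq> (\<Union>s\<in>S. {s<..s + e})"
    using S by (auto simp: clusters_def bridged_def subset_iff less_Suc_eq_le)
  ultimately have "S = linked_starts e k"
    using S assms by (intro eq_linked_starts_if_cover) auto
  then show "S \<in> {linked_starts e k}" by simp
qed (simp add: card_linked_starts linked_starts_in_clusters assms)

definition linked_count :: "nat list \<Rightarrow> nat \<Rightarrow> nat \<Rightarrow> nat" where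
  "linked_count p e k = marked_count p (Suc (k * e)) (linked_starts e k)"

lemma strongly_cWilf_equiv_linked_count:
  assumes "strongly_cWilf_equiv p q" and "e > 0" "length p = Suc e" "length q = Suc e"
  shows "linked_count p e k = linked_count q e k"
proof -
  let ?n = "Suc (k * e)" and ?x = "monom 1 1 :: int poly"
  have linked_coeff: "coeff (cluster_sum r ?x ?n) k = int (linked_count r e k)"
    if "length r = Suc e" for r
    using that
    by (simp only: coeff_cluster_sum clusters_card_eq_linked_starts[OF \<open>e > 0\<close>])
      (simp add: linked_count_def)
  have "marked_sum p ?x n = marked_sum q ?x n" for n
    using assms(1) by (simp add: marked_sum_eq_sum_a_count strongly_cWilf_equiv_def)
  then have "cluster_sum p ?x ?n = cluster_sum q ?x ?n"
    using assms(3,4) by (intro cluster_sum_cong) auto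
  then show ?thesis using linked_coeff[OF assms(3)] linked_coeff[OF assms(4)] by simp
qed

section \<open>An upper bound for linked clusters\<close>

definition increasing_along :: "nat list \<Rightarrow> 'a::linorder list \<Rightarrow> bool" where
  "increasing_along qs w \<longleftrightarrow> sorted_wrt (<) (map ((!) w) qs)"

lemma distinct_if_increasing_along: "increasing_along qs w \<Longrightarrow> distinct qs"
  by (auto simp: increasing_along_def strict_sorted_iff distinct_map)

lemma permutations_eq_if_increasing_along:
  fixes u v :: "'a::linorder list"
  assumes u: "u \<in> permutations_of_set A" "increasing_along qs u"
    and v: "v \<in> permutations_of_set A" "increasing_along qs v"
    and qs: "set qs \<subseteq> {..<card A}"
    and eq_off_qs: "\<And>i. i \<in> {..<card A} - set qs \<Longrightarrow> u ! i = v ! i"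
  shows "u = v"
proof -
  have values_on_qs: "set (map ((!) w) qs) = A - (!) w ` ({..<card A} - set qs)"
    if w: "w \<in> permutations_of_set A" for w
  proof -
    let ?I = "{..<card A}"
    have inj: "inj_on ((!) w) ?I" and image: "(!) w ` ?I = A"
      using permutations_of_setD[OF w] length_finite_permutations_of_set[OF w]
      by (auto simp: inj_on_nth set_conv_nth)
    have "(!) w ` set qs = (!) w ` (?I - (?I - set qs))"
      using qs by (simp add: double_diff)
    also have "\<dots> = A - (!) w ` (?I - set qs)"
      using inj_on_image_set_diff[OF inj, of ?I "?I - set qs"] by (simp add: image)
    finally show ?thesis by simp
  qed
  have "(!) u ` ({..<card A} - set qs) = (!) v ` ({..<card A} - set qs)"
    using eq_off_qs by (intro image_cong) auto
  then have "set (map ((!) u) qs) = set (map ((!) v) qs)"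
    by (simp only: values_on_qs[OF u(1)] values_on_qs[OF v(1)])
  then have "map ((!) u) qs = map ((!) v) qs"
    using u(2) v(2) unfolding increasing_along_def
    by (intro sorted_distinct_set_unique) (simp_all only: strict_sorted_iff)
  then have "u ! i = v ! i" if "i < card A" for i
    using eq_off_qs that by (cases "i \<in> set qs") auto
  then show ?thesis
    using u(1) v(1) by (intro nth_equalityI) (auto simp: length_finite_permutations_of_set)
qed

lemma card_increasing_along_le:
  fixes A :: "'a::linorder set"
  assumes "finite A" and qs: "set qs \<subseteq> {..<card A}"
  shows "card {w \<in> permutations_of_set A. increasing_along qs w} * fact (length qs) \<le> fact (card A)"
    (is "card ?W * _ \<le> _")
proof (cases "distinct qs")
  case False
  then have "?W = {}" by (auto dest: distinct_if_increasing_along)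
  then show ?thesis by (simp only: card.empty mult_0 le0)
next
  case distinct: True
  let ?n = "card A" and ?r = "length qs"
  let ?L = "{xs. length xs = ?n - ?r \<and> distinct xs \<and> set xs \<subseteq> A}"
  have "?r \<le> ?n" using card_mono[OF _ qs] distinct_card[OF distinct] by simp
  obtain ps where ps: "set ps = {..<?n} - set qs" "distinct ps"
    using finite_distinct_list[of "{..<?n} - set qs"] by auto
  then have length_ps: "length ps = ?n - ?r"
    using distinct_card[OF distinct] distinct_card[OF ps(2)] qs by (simp add: card_Diff_subset)
  have "inj_on (\<lambda>w. map ((!) w) ps) ?W"
    by (intro inj_onI permutations_eq_if_increasing_along[OF _ _ _ _ qs]) (simp_all add: ps(1))
  moreover have "(\<lambda>w. map ((!) w) ps) ` ?W \<subseteq> ?L"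
  proof (intro image_subsetI)
    fix w assume "w \<in> ?W"
    then have "distinct w" "set w = A" "length w = ?n"
      using length_finite_permutations_of_set[of w A] by (auto dest: permutations_of_setD)
    moreover have "i < ?n" if "i \<in> set ps" for i using that ps(1) by simp
    ultimately show "map ((!) w) ps \<in> ?L"
      using ps(2) length_ps by (simp add: distinct_map inj_on_nth image_subset_iff) (metis nth_mem)
  qed
  moreover have "finite ?L"
    by (rule finite_subset[OF _ finite_lists_length_eq[OF assms(1), of "?n - ?r"]]) auto
  ultimately have "card ?W \<le> card ?L" by (rule card_inj_on_le)
  also have "card ?L = \<Prod>{Suc ?r..?n}"
    using \<open>finite A\<close> \<open>?r \<le> ?n\<close> by (subst card_lists_distinct_length_eq) auto
  finally have "card ?W * fact ?r \<le> \<Prod>{Suc ?r..?n} * fact ?r" by simp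
  also have "\<dots> = fact ?n"
    using \<open>?r \<le> ?n\<close> by (simp add: fact_eq_fact_times[of ?r ?n] mult.commute)
  finally show ?thesis .
qed

primrec linked_chain :: "nat \<Rightarrow> nat list \<Rightarrow> nat \<Rightarrow> nat list" where
  "linked_chain e ts 0 = [0]"
| "linked_chain e ts (Suc k) = linked_chain e ts k @ map ((+) (k * e)) ts"

lemma length_linked_chain: "length (linked_chain e ts k) = Suc (k * length ts)"
  by (induction k) simp_all

lemma set_linked_chain:
  assumes "set ts \<subseteq> {..e}"
  shows "set (linked_chain e ts k) \<subseteq> {..k * e}"
  using assms by (induction k) auto

lemma last_linked_chain:
  assumes "ts \<noteq> []" "last ts = e"
  shows "last (linked_chain e ts k) = k * e"
  using assms by (induction k) (simp_all add: last_map)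

lemma increasing_along_linked_chain:
  assumes "length p = Suc e" "increasing_along (0 # ts) p"
    and ts: "ts \<noteq> []" "set ts \<subseteq> {..e}" "last ts = e"
    and "linked_starts e k \<subseteq> occurrences p w"
  shows "increasing_along (linked_chain e ts k) w"
  using assms(6) unfolding increasing_along_def
proof (induction k)
  case 0
  then show ?case by simp
next
  case (Suc k)
  let ?qs = "linked_chain e ts k"
  have sorted_qs: "sorted_wrt (<) (map ((!) w) ?qs)" using Suc by (simp add: linked_starts_Suc)
  have increasing_ts: "sorted_wrt (\<lambda>x y. p ! x < p ! y) ts" "\<forall>t\<in>set ts. p ! 0 < p ! t"
    using assms(2) by (simp_all add: increasing_along_def sorted_wrt_map)
  have "k * e \<in> occurrences p w" using Suc.prems by (simp add: linked_starts_Suc)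
  then have less_iff: "w ! (k * e + x) < w ! (k * e + y) \<longleftrightarrow> p ! x < p ! y" if "x \<le> e" "y \<le> e" for x y
    using occurrence_less_iff that assms(1) by simp
  have "sorted_wrt (\<lambda>x y. w ! (k * e + x) < w ! (k * e + y)) ts"
    by (rule sorted_wrt_mono_rel[OF _ increasing_ts(1)]) (use ts(2) less_iff in auto)
  moreover have "w ! q < w ! (k * e + t)" if "q \<in> set ?qs" "t \<in> set ts" for q t
  proof -
    have "?qs \<noteq> []" using length_linked_chain[of e ts k] by auto
    then have "w ! q \<le> w ! last ?qs"
      using sorted_qs that(1)
      by (cases ?qs rule: rev_cases) (auto simp: sorted_wrt_append)
    also have "\<dots> = w ! (k * e + 0)" using last_linked_chain[OF ts(1,3)] by simp
    also have "\<dots> < w ! (k * e + t)"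
      using less_iff[of 0 t] increasing_ts(2) ts(2) that(2) by auto
    finally show ?thesis .
  qed
  ultimately show ?case
    using sorted_qs by (auto simp: sorted_wrt_append sorted_wrt_map)
qed

lemma obtain_chain_between_ends:
  assumes p: "p \<in> perms (Suc e)" and asc: "p ! 0 < p ! e"
  obtains ts where "ts \<noteq> []" "set ts \<subseteq> {..e}" "last ts = e" "length ts = p ! e - p ! 0"
    "increasing_along (0 # ts) p"
proof -
  let ?ranks = "[Suc (p ! 0)..<Suc (p ! e)]"
  have "p ! e \<in> set p" using permsD(1)[OF p] by simp
  then have "?ranks \<in> lists (set p)" unfolding permsD(3)[OF p] lists_eq_set by auto
  also have "set p = (!) p ` {..e}"
    using permsD(1)[OF p] by (auto simp: set_conv_nth less_Suc_eq_le)
  finally have "?ranks \<in> map ((!) p) ` lists {..e}" by (simp only: lists_image)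
  then obtain ts where ts: "set ts \<subseteq> {..e}" and ranks: "map ((!) p) ts = ?ranks"
    unfolding lists_eq_set by (metis (mono_tags) imageE mem_Collect_eq)
  have "ts \<noteq> []" using ranks asc by auto
  moreover have "last ts = e"
  proof -
    have "p ! last ts = p ! e" using ranks asc last_map[OF \<open>ts \<noteq> []\<close>, of "(!) p"] by simp
    moreover have "last ts \<le> e" using ts last_in_set[OF \<open>ts \<noteq> []\<close>] by auto
    ultimately show ?thesis using permsD(1,2)[OF p] by (simp add: nth_eq_iff_index_eq)
  qed
  moreover have "length ts = p ! e - p ! 0" using arg_cong[OF ranks, of length] by (simp del: upt_Suc)
  moreover have "increasing_along (0 # ts) p"
    unfolding increasing_along_def list.map ranks by (auto simp del: upt_Suc)
  ultimately show thesis using that ts by blast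
qed

lemma linked_count_mult_fact_le:
  assumes p: "p \<in> perms (Suc e)" and asc: "p ! 0 < p ! e"
  shows "linked_count p e k * fact (Suc (k * (p ! e - p ! 0))) \<le> fact (Suc (k * e))"
proof -
  let ?A = "{1..Suc (k * e)}"
  obtain ts where ts: "ts \<noteq> []" "set ts \<subseteq> {..e}" "last ts = e" "length ts = p ! e - p ! 0"
    and increasing: "increasing_along (0 # ts) p"
    using obtain_chain_between_ends[OF p asc] .
  let ?qs = "linked_chain e ts k"
  let ?W = "{w \<in> permutations_of_set ?A. increasing_along ?qs w}"
  have "marked_words p ?A (linked_starts e k) \<subseteq> ?W"
    using increasing_along_linked_chain[OF permsD(1)[OF p] increasing ts(1-3)]
    by (auto simp: marked_words_def)
  then have "linked_count p e k * fact (length ?qs) \<le> card ?W * fact (length ?qs)"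
    unfolding linked_count_def marked_count_def by (intro mult_le_mono1 card_mono) auto
  also have "\<dots> \<le> fact (card ?A)"
    using set_linked_chain[OF ts(2), of k]
    by (intro card_increasing_along_le) (auto simp: less_Suc_eq_le)
  finally show ?thesis by (simp add: length_linked_chain ts(4))
qed

section \<open>A lower bound for linked clusters\<close>

definition links :: "nat list \<Rightarrow> (nat \<Rightarrow> nat \<Rightarrow> nat) \<Rightarrow> bool" where
  "links p f \<longleftrightarrow> (\<forall>i. f i (last p) = f (Suc i) (hd p))"

primrec glued_word :: "nat list \<Rightarrow> (nat \<Rightarrow> nat \<Rightarrow> nat) \<Rightarrow> nat \<Rightarrow> nat list" where
  "glued_word p f 0 = [f 0 (hd p)]"
| "glued_word p f (Suc k) = glued_word p f k @ map (f k) (tl p)"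

lemma length_glued_word: "length (glued_word p f k) = Suc (k * (length p - 1))"
  by (induction k) simp_all

lemma last_glued_word:
  assumes "p \<noteq> []" and "links p f"
  shows "last (glued_word p f k) = f k (hd p)"
proof (induction k)
  case (Suc k)
  then show ?case
    using assms by (cases p) (auto simp: links_def last_map last_append)
qed simp

lemma set_glued_word:
  assumes "p \<noteq> []" and "links p f"
  shows "set (glued_word p f k) = insert (f 0 (hd p)) (\<Union>i<k. f i ` set p)"
proof (induction k)
  case (Suc k)
  have "f k (hd p) \<in> set (glued_word p f k)"
    using last_in_set[of "glued_word p f k"] length_glued_word[of p f k]
    by (fastforce simp: last_glued_word[OF assms])
  moreover have "f k ` set p = insert (f k (hd p)) (f k ` set (tl p))"
    using \<open>p \<noteq> []\<close> by (cases p) auto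
  ultimately show ?case using Suc by (auto simp: lessThan_Suc)
qed simp

lemma factor_glued_word:
  assumes "p \<noteq> []" and "links p f" and "i < k"
  shows "take (length p) (drop (i * (length p - 1)) (glued_word p f k)) = map (f i) p"
  using \<open>i < k\<close>
proof (induction k)
  case (Suc k)
  let ?e = "length p - 1" and ?w = "glued_word p f k"
  show ?case
  proof (cases "i = k")
    case True
    have "?w \<noteq> []" using length_glued_word[of p f k] by auto
    then have "?w = butlast ?w @ [last ?w]" "length (butlast ?w) = k * ?e"
      by (simp_all add: length_glued_word)
    then have "drop (k * ?e) ?w = [f k (hd p)]"
      unfolding last_glued_word[OF assms(1,2)] by (metis append_eq_conv_conj)
    then show ?thesis
      using True \<open>p \<noteq> []\<close> by (cases p) (simp_all add: length_glued_word)
  next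
    case False
    then have "i < k" using Suc.prems by simp
    then have "i * ?e + ?e \<le> k * ?e" using mult_le_mono1[of "Suc i" k ?e] by simp
    then have "length p \<le> length ?w - i * ?e"
      using \<open>p \<noteq> []\<close> by (cases p) (simp_all add: length_glued_word)
    then show ?thesis using Suc.IH[OF \<open>i < k\<close>] by simp
  qed
qed simp

lemma linked_starts_subset_occurrences_glued_word:
  assumes p: "p \<in> perms (Suc e)" and "links p f"
    and mono: "\<And>i. i < k \<Longrightarrow> strict_mono_on {1..Suc e} (f i)"
  shows "linked_starts e k \<subseteq> occurrences p (glued_word p f k)"
proof -
  have "i * e \<in> occurrences p (glued_word p f k)" if "i < k" for i
  proof -
    have "st (map (f i) p) = p"
      using st_map[of p "f i"] mono[OF that] by (simp add: permsD(3)[OF p] st_perms[OF p])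
    moreover have "i * e + e \<le> k * e" using mult_le_mono1[of "Suc i" k e] that by simp
    ultimately show ?thesis
      using factor_glued_word[OF perms_ends(1)[OF p] \<open>links p f\<close> that]
      by (simp add: occurrences_def starts_def length_glued_word permsD(1)[OF p])
  qed
  then show ?thesis by (auto simp: linked_starts_def)
qed

lemma image_mult_add_eq_atMost:
  assumes "0 < k" "0 < d"
  shows "(\<lambda>(i, t). i * d + t) ` ({..<k} \<times> {..d}) = {..k * d :: nat}"
proof (intro equalityI subsetI)
  fix c assume "c \<in> (\<lambda>(i, t). i * d + t) ` ({..<k} \<times> {..d})"
  then obtain i t where "c = i * d + t" "i < k" "t \<le> d" by auto
  then show "c \<in> {..k * d}" using mult_le_mono1[of "Suc i" k d] by simp
next
  fix c assume c: "c \<in> {..k * d}"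
  show "c \<in> (\<lambda>(i, t). i * d + t) ` ({..<k} \<times> {..d})"
  proof (cases "c = k * d")
    case True
    then have "c = (k - 1) * d + d" using assms(1) by (cases k) auto
    then show ?thesis using assms(1) by (intro image_eqI[of _ _ "(k - 1, d)"]) auto
  next
    case False
    then have "c div d < k" using c by (simp add: less_mult_imp_div_less)
    then show ?thesis
      using mod_less_divisor[OF assms(2), of c]
      by (intro image_eqI[of _ _ "(c div d, c mod d)"]) (auto simp: div_mult_mod_eq)
  qed
qed

text \<open>Entries for \<open>k\<close> linked copies of a pattern in \<open>perms (Suc e)\<close> with end points \<open>a < b\<close>. The entries
  of rank between \<open>a\<close> and \<open>b\<close> of all copies form one chain on level \<open>a\<close>. The \<open>k\<close> entries of any other
  rank \<open>v\<close> occupy level \<open>v\<close>, distributed over the copies by an arbitrary permutation \<open>r v\<close>.\<close>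

locale linked_copies =
  fixes a b e k :: nat
  assumes bounds: "0 < a" "a < b" "b \<le> Suc e" "0 < k"
begin

definition outer :: "nat set" where
  "outer = {1..Suc e} - {a..b}"

definition level :: "nat \<Rightarrow> nat" where
  "level v = (if v \<in> {a..b} then a else v)"

definition offset :: "(nat \<Rightarrow> nat list) \<Rightarrow> nat \<Rightarrow> nat \<Rightarrow> nat" where
  "offset r i v = (if v \<in> {a..b} then i * (b - a) + (v - a) else r v ! i)"

definition encode :: "nat \<Rightarrow> nat \<Rightarrow> nat" where
  "encode u c = Suc (k * e) * u + c"

definition entry :: "(nat \<Rightarrow> nat list) \<Rightarrow> nat \<Rightarrow> nat \<Rightarrow> nat" where
  "entry r i v = encode (level v) (offset r i v)"

definition offsets :: "nat \<Rightarrow> nat set" where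
  "offsets u = (if u = a then {..k * (b - a)} else {..<k})"

definition entries :: "nat set" where
  "entries = case_prod encode ` Sigma (insert a outer) offsets"

definition arrangements :: "(nat \<Rightarrow> nat list) set" where
  "arrangements = (\<Pi>\<^sub>E v\<in>outer. permutations_of_set {..<k})"

lemma offsets_subset: "offsets u \<subseteq> {..k * e}"
proof
  fix c assume "c \<in> offsets u"
  then have "c \<le> k * (b - a) \<or> c \<le> k * 1" by (auto simp: offsets_def split: if_splits)
  moreover have "k * (b - a) \<le> k * e" "k * 1 \<le> k * e" using bounds by (intro mult_le_mono2; simp)+
  ultimately show "c \<in> {..k * e}" unfolding atMost_iff by linarith
qed

lemma card_outer: "card outer = e - (b - a)"
  unfolding outer_def using bounds by (subst card_Diff_subset) auto

lemma arrangement_nth: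
  assumes "r \<in> arrangements" "v \<in> outer"
  shows "length (r v) = k" "(!) (r v) ` {..<k} = {..<k}"
proof -
  have rv: "r v \<in> permutations_of_set {..<k}"
    using assms by (auto simp: arrangements_def dest: PiE_mem)
  then show "length (r v) = k" using length_finite_permutations_of_set[OF rv] by simp
  then show "(!) (r v) ` {..<k} = {..<k}"
    using permutations_of_setD(1)[OF rv] by (auto simp: set_conv_nth)
qed

lemma image_offset_level:
  assumes "r \<in> arrangements" "u \<in> insert a outer"
  shows "(\<lambda>(i, v). offset r i v) ` ({..<k} \<times> {v \<in> {1..Suc e}. level v = u}) = offsets u"
proof (cases "u = a")
  case True
  have "{v \<in> {1..Suc e}. level v = a} = {a..b}" using bounds by (auto simp: level_def)
  moreover have "(\<lambda>(i, v). i * (b - a) + (v - a)) ` ({..<k} \<times> {a..b}) = {..k * (b - a)}"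
  proof -
    have "t \<in> (\<lambda>v. v - a) ` {a..b}" if "t \<le> b - a" for t
      using that bounds by (intro image_eqI[of _ _ "t + a"]) auto
    then have "(\<lambda>v. v - a) ` {a..b} = {..b - a}" by auto
    then have "{..<k} \<times> {..b - a} = map_prod id (\<lambda>v. v - a) ` ({..<k} \<times> {a..b})"
      by (simp add: map_prod_surj_on)
    then show ?thesis
      using image_mult_add_eq_atMost[of k "b - a"] bounds by (simp add: image_image case_prod_unfold)
  qed
  moreover have "(\<lambda>(i, v). offset r i v) ` ({..<k} \<times> {a..b})
      = (\<lambda>(i, v). i * (b - a) + (v - a)) ` ({..<k} \<times> {a..b})"
    by (intro image_cong) (auto simp: offset_def)
  ultimately show ?thesis using True by (simp only: offsets_def simp_thms if_True)
next
  case False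
  then have "{v \<in> {1..Suc e}. level v = u} = {u}" "u \<in> outer" "u \<notin> {a..b}"
    using assms(2) by (auto simp: level_def outer_def)
  then show ?thesis
    using False arrangement_nth(2)[OF assms(1), of u] by (auto simp: offset_def offsets_def image_def)
qed

lemma level_mem:
  assumes "v \<in> {1..Suc e}"
  shows "level v \<in> insert a outer"
  using assms by (auto simp: level_def outer_def)

lemma offset_mem_offsets:
  assumes "r \<in> arrangements" "i < k" "v \<in> {1..Suc e}"
  shows "offset r i v \<in> offsets (level v)"
  unfolding image_offset_level[OF assms(1) level_mem[OF assms(3)], symmetric]
  using assms(2,3) by (intro image_eqI[of _ _ "(i, v)"]) auto

lemma Union_entry_image:
  assumes "r \<in> arrangements"
  shows "(\<Union>i<k. entry r i ` {1..Suc e}) = entries"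
proof (intro equalityI subsetI)
  fix x assume "x \<in> (\<Union>i<k. entry r i ` {1..Suc e})"
  then obtain i v where "i < k" "v \<in> {1..Suc e}" "x = encode (level v) (offset r i v)"
    unfolding entry_def by blast
  then show "x \<in> entries"
    using offset_mem_offsets[OF assms] level_mem
    unfolding entries_def by (intro image_eqI[of _ _ "(level v, offset r i v)"]) simp_all
next
  fix x assume "x \<in> entries"
  then obtain u c where u: "u \<in> insert a outer" and c: "c \<in> offsets u" and x: "x = encode u c"
    by (auto simp: entries_def)
  have "c \<in> (\<lambda>(i, v). offset r i v) ` ({..<k} \<times> {v \<in> {1..Suc e}. level v = u})"
    using c by (simp only: image_offset_level[OF assms u])
  then obtain i v where "i < k" "v \<in> {1..Suc e}" "level v = u" "offset r i v = c" by auto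
  then have "i < k" "v \<in> {1..Suc e}" "x = entry r i v" using x by (simp_all add: entry_def)
  then show "x \<in> (\<Union>i<k. entry r i ` {1..Suc e})" by blast
qed

lemma encode_less:
  assumes "u < v" "c \<le> k * e"
  shows "encode u c < encode v d"
proof -
  have "encode u c < Suc (k * e) * Suc u" using assms(2) by (simp add: encode_def)
  also have "\<dots> \<le> Suc (k * e) * v" using assms(1) by (intro mult_le_mono2) simp
  finally show ?thesis by (simp add: encode_def)
qed

lemma card_entries: "card entries = Suc (k * e)"
proof -
  have "inj_on (case_prod encode) (Sigma (insert a outer) offsets)"
  proof (rule inj_onI, clarify)
    fix u c v d assume "c \<in> offsets u" "d \<in> offsets v" "encode u c = encode v d"
    moreover from this have "u = v"
      using offsets_subset encode_less[of u v c d] encode_less[of v u d c]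
      by (cases u v rule: linorder_cases) auto
    ultimately show "u = v \<and> c = d" by (simp add: encode_def)
  qed
  then have "card entries = (\<Sum>u\<in>insert a outer. card (offsets u))"
    unfolding entries_def by (subst card_image) (auto simp: outer_def offsets_def)
  also have "\<dots> = card (offsets a) + (\<Sum>u\<in>outer. card (offsets u))"
    using bounds by (intro sum.insert) (auto simp: outer_def)
  also have "(\<Sum>u\<in>outer. card (offsets u)) = (\<Sum>u\<in>outer. k)"
    using bounds by (intro sum.cong) (auto simp: outer_def offsets_def)
  also have "card (offsets a) + \<dots> = Suc (k * (b - a) + k * (e - (b - a)))"
    by (simp add: offsets_def card_outer)
  also have "\<dots> = Suc (k * e)" using bounds by (simp flip: distrib_left)
  finally show ?thesis .
qed

lemma strict_mono_on_entry:
  assumes "r \<in> arrangements" "i < k"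
  shows "strict_mono_on {1..Suc e} (entry r i)"
proof (rule strict_mono_onI)
  fix u v assume uv: "u \<in> {1..Suc e}" "v \<in> {1..Suc e}" "u < v"
  show "entry r i u < entry r i v"
  proof (cases "level u = level v")
    case True
    then have "u \<in> {a..b}" "v \<in> {a..b}" using uv(3) by (auto simp: level_def split: if_splits)
    then show ?thesis using uv(3) by (simp add: entry_def encode_def level_def offset_def)
  next
    case False
    then have "level u < level v" using uv(3) by (auto simp: level_def split: if_splits)
    moreover have "offset r i u \<le> k * e"
      using offset_mem_offsets[OF assms uv(1)] offsets_subset by auto
    ultimately show ?thesis by (simp add: entry_def encode_less)
  qed
qed

lemma links_entry:
  assumes "hd p = a" "last p = b"
  shows "links p (entry r)"
  using bounds assms by (simp add: links_def entry_def level_def offset_def add.commute)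

lemma glued_word_entry_in_marked_words:
  assumes p: "p \<in> perms (Suc e)" and ends: "hd p = a" "last p = b" and r: "r \<in> arrangements"
  shows "glued_word p (entry r) k \<in> marked_words p entries (linked_starts e k)"
proof -
  let ?w = "glued_word p (entry r) k"
  have "set ?w = insert (entry r 0 (hd p)) (\<Union>i<k. entry r i ` {1..Suc e})"
    using set_glued_word[OF perms_ends(1)[OF p] links_entry[OF ends]] by (simp only: permsD(3)[OF p])
  also have "\<dots> = (\<Union>i<k. entry r i ` {1..Suc e})"
    using bounds by (auto simp: ends(1))
  finally have "set ?w = entries" using Union_entry_image[OF r] by simp
  moreover from this have "distinct ?w"
    by (intro card_distinct) (simp add: card_entries length_glued_word permsD(1)[OF p])
  moreover have "linked_starts e k \<subseteq> occurrences p ?w"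
    using strict_mono_on_entry[OF r]
    by (rule linked_starts_subset_occurrences_glued_word[OF p links_entry[OF ends]])
  ultimately show ?thesis by (simp add: marked_words_def permutations_of_setI)
qed

lemma inj_on_glued_word_entry:
  assumes p: "p \<in> perms (Suc e)" and ends: "hd p = a" "last p = b"
  shows "inj_on (\<lambda>r. glued_word p (entry r) k) arrangements"
proof (rule inj_onI)
  fix r s assume r: "r \<in> arrangements" and s: "s \<in> arrangements"
    and eq: "glued_word p (entry r) k = glued_word p (entry s) k"
  have "r v = s v" if v: "v \<in> outer" for v
  proof (rule nth_equalityI)
    show "length (r v) = length (s v)" using arrangement_nth(1) r s v by simp
    fix i assume "i < length (r v)"
    then have "i < k" using arrangement_nth(1)[OF r v] by simp
    then have "map (entry r i) p = map (entry s i) p"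
      using factor_glued_word[OF perms_ends(1)[OF p] links_entry[OF ends]] eq by metis
    then have "entry r i v = entry s i v" using v permsD(3)[OF p] by (auto simp: outer_def)
    then show "r v ! i = s v ! i"
      using v by (auto simp: entry_def encode_def offset_def outer_def split: if_splits)
  qed
  then show "r = s" using r s unfolding arrangements_def by (intro PiE_ext) auto
qed

lemma card_arrangements: "card arrangements = fact k ^ (e - (b - a))"
  unfolding arrangements_def by (subst card_PiE) (auto simp: card_outer, simp add: outer_def)

end

lemma fact_power_le_linked_count:
  assumes p: "p \<in> perms (Suc e)" and asc: "p ! 0 < p ! e" and "k > 0"
  shows "fact k ^ (e - (p ! e - p ! 0)) \<le> linked_count p e k"
proof -
  have "p ! 0 \<in> {1..Suc e}" "p ! e \<in> {1..Suc e}"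
    using permsD(1)[OF p] nth_mem[of _ p] unfolding permsD(3)[OF p, symmetric] by simp_all
  then interpret linked_copies "p ! 0" "p ! e" e k
    using asc \<open>k > 0\<close> by (intro linked_copies.intro) simp_all
  have "(\<lambda>r. glued_word p (entry r) k) ` arrangements \<subseteq> marked_words p entries (linked_starts e k)"
    using glued_word_entry_in_marked_words[OF p perms_ends(2,3)[OF p]] by blast
  then have "card arrangements \<le> card (marked_words p entries (linked_starts e k))"
    by (intro card_inj_on_le[OF inj_on_glued_word_entry[OF p perms_ends(2,3)[OF p]]])
      (simp_all add: marked_words_def)
  moreover have "finite entries" using card_entries by (intro card_ge_0_finite) simp
  ultimately show ?thesis
    by (simp add: card_marked_words card_entries card_arrangements linked_count_def)
qed

section \<open>Growth rates\<close>

lemma fact_le_power_mult_fact: "fact (m + r) \<le> (m + r) ^ r * (fact m :: nat)"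
proof -
  have "fact (m + r) = fact (m + r) div fact m * (fact m :: nat)"
    by (simp add: fact_dvd)
  also have "\<dots> \<le> (m + r) ^ r * fact m"
    using fact_div_fact_le_pow[of r "m + r"] by (intro mult_le_mono1) simp
  finally show ?thesis .
qed

lemma power_mult_fact_le_fact: "m ^ r * fact m \<le> (fact (m + r) :: nat)"
proof (induction r)
  case (Suc r)
  have "m ^ Suc r * fact m = m * (m ^ r * fact m)" by simp
  also have "\<dots> \<le> Suc (m + r) * fact (m + r)" using Suc by (intro mult_le_mono) auto
  finally show ?case by simp
qed simp

lemma power_self_le_fact: "k ^ k \<le> 4 ^ k * (fact k :: nat)"
proof -
  have "k ^ k * fact k \<le> (fact (k + k) :: nat)" by (rule power_mult_fact_le_fact)
  also have "\<dots> = fact k * fact k * ((k + k) choose k)"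
    using binomial_fact_lemma[of k "k + k"] by simp
  also have "\<dots> \<le> fact k * fact k * 2 ^ (k + k)"
    using binomial_le_pow2[of "k + k" k] by (intro mult_le_mono2)
  also have "(2::nat) ^ (k + k) = 4 ^ k" by (simp add: power_add power_mult_distrib[symmetric])
  finally have "k ^ k * fact k \<le> (4 ^ k * fact k) * fact k" by (simp add: mult_ac)
  then show ?thesis by (simp add: mult_le_cancel2)
qed

lemma mult_power_less_fact_power:
  assumes "k > 4 ^ Suc q * c ^ q"
  shows "(k * c) ^ (k * q) < fact k ^ Suc q"
proof -
  have "k > 0" using assms by simp
  have "4 ^ Suc q * (k * c) ^ q = (4 ^ Suc q * c ^ q) * k ^ q"
    by (simp only: power_mult_distrib mult_ac)
  also have "\<dots> < k ^ Suc q" using assms \<open>k > 0\<close> by simp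
  finally have "(4 ^ Suc q * (k * c) ^ q) ^ k < (k ^ Suc q) ^ k"
    using \<open>k > 0\<close> by (intro power_strict_mono) auto
  also have "(k ^ Suc q) ^ k = (k ^ k) ^ Suc q" by (simp only: power_mult[symmetric] mult.commute)
  also have "\<dots> \<le> (4 ^ k * fact k) ^ Suc q" using power_self_le_fact by (intro power_mono) auto
  finally have "(4 ^ Suc q) ^ k * (k * c) ^ (k * q) < (4 ^ Suc q) ^ k * fact k ^ Suc q"
    by (simp only: power_mult_distrib power_mult[symmetric] mult.commute)
  then show ?thesis by (simp only: mult_less_cancel1)
qed

lemma obtain_fact_less_fact_power_mult_fact:
  assumes "d < d'" "d' \<le> e"
  obtains k where "k > 0" "fact (Suc (k * e)) < fact k ^ (e - d) * (fact (Suc (k * d')) :: nat)"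
proof -
  define q where "q = e - d - 1"
  have q: "e - d = Suc q" "e - d' \<le> q" using assms by (simp_all add: q_def)
  define k where "k = Suc (4 ^ Suc q * Suc e ^ q)"
  have "k > 0" by (simp add: k_def)
  have split: "Suc (k * e) = Suc (k * d') + k * (e - d')"
    using assms(2) by (simp add: add_mult_distrib2[symmetric])
  have "(fact (Suc (k * e)) :: nat) \<le> Suc (k * e) ^ (k * (e - d')) * fact (Suc (k * d'))"
    unfolding split by (rule fact_le_power_mult_fact)
  also have "\<dots> \<le> (k * Suc e) ^ (k * q) * fact (Suc (k * d'))"
  proof (rule mult_le_mono1)
    have "Suc (k * e) ^ (k * (e - d')) \<le> (k * Suc e) ^ (k * (e - d'))"
      using \<open>k > 0\<close> by (intro power_mono) auto
    also have "\<dots> \<le> (k * Suc e) ^ (k * q)"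
      using \<open>k > 0\<close> q(2) by (intro power_increasing mult_le_mono2) auto
    finally show "Suc (k * e) ^ (k * (e - d')) \<le> (k * Suc e) ^ (k * q)" .
  qed
  also have "\<dots> < fact k ^ (e - d) * fact (Suc (k * d'))"
    unfolding q(1) by (intro mult_strict_right_mono mult_power_less_fact_power) (simp_all add: k_def)
  finally show thesis using that \<open>k > 0\<close> by blast
qed

lemma strongly_cWilf_equiv_end_difference_le:
  assumes p: "p \<in> perms (Suc e)" "p ! 0 < p ! e"
    and q: "q \<in> perms (Suc e)" "q ! 0 < q ! e"
    and equiv: "strongly_cWilf_equiv p q"
  shows "q ! e - q ! 0 \<le> p ! e - p ! 0"
proof (rule ccontr)
  let ?d = "p ! e - p ! 0" and ?d' = "q ! e - q ! 0"
  assume "\<not> ?d' \<le> ?d"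
  moreover have "?d' \<le> e"
    using nth_mem[of 0 q] nth_mem[of e q] permsD(1,3)[OF q(1)] by auto
  ultimately obtain k where "k > 0"
    and less: "fact (Suc (k * e)) < fact k ^ (e - ?d) * (fact (Suc (k * ?d')) :: nat)"
    using obtain_fact_less_fact_power_mult_fact[of ?d ?d' e] by auto
  have "e > 0" using p(2) by (cases e) auto
  have "fact k ^ (e - ?d) \<le> linked_count p e k"
    by (rule fact_power_le_linked_count[OF p \<open>k > 0\<close>])
  also have "\<dots> = linked_count q e k"
    using permsD(1)[OF p(1)] permsD(1)[OF q(1)]
    by (rule strongly_cWilf_equiv_linked_count[OF equiv \<open>e > 0\<close>])
  finally have "fact k ^ (e - ?d) * fact (Suc (k * ?d')) \<le> linked_count q e k * fact (Suc (k * ?d'))"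
    by (rule mult_le_mono1)
  also have "\<dots> \<le> fact (Suc (k * e))" by (rule linked_count_mult_fact_le[OF q])
  finally show False using less by simp
qed

theorem theorem1p9:
  fixes pi tau :: "nat list" and m :: nat
  assumes "pi \<in> perms m" and "tau \<in> perms m"
    and "standard_form pi" and "standard_form tau"
    and "strongly_cWilf_equiv pi tau"
  shows "int (pi ! (m - 1)) - int (pi ! 0) = int (tau ! (m - 1)) - int (tau ! 0)"
proof (cases m)
  case 0
  then show ?thesis using permsD(1)[OF assms(1)] permsD(1)[OF assms(2)] by simp
next
  case (Suc e)
  have pi: "pi \<in> perms (Suc e)" "pi ! 0 < pi ! e" and tau: "tau \<in> perms (Suc e)" "tau ! 0 < tau ! e"
    using assms(1-4) perms_ends unfolding Suc by (simp_all add: standard_form_def)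
  have "pi ! e - pi ! 0 = tau ! e - tau ! 0"
  proof (rule antisym)
    show "tau ! e - tau ! 0 \<le> pi ! e - pi ! 0"
      using assms(5) by (rule strongly_cWilf_equiv_end_difference_le[OF pi tau])
    have "strongly_cWilf_equiv tau pi" using assms(5) by (simp add: strongly_cWilf_equiv_def)
    then show "pi ! e - pi ! 0 \<le> tau ! e - tau ! 0"
      by (rule strongly_cWilf_equiv_end_difference_le[OF tau pi])
  qed
  then show ?thesis using pi(2) tau(2) by (simp add: Suc)
qed

end
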